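(* Let $Q=(q_{ij})$ be a real symmetric $n\times n$ matrix with zero diagonal, $c\in\mathbb{R}^n$, $R_i=\{j:q_{ij}\neq0\}$, and let $\alpha_{ij}>0$ for $j\in R_i$, $i=1,\dots,n$. Consider the MILP PK($\alpha$) in variables $x_i$ and $y_{ij}$ ($j\in R_i$): maximize $\sum_{i=1}^n\sum_{j\in R_i}q_{ij}y_{ij}+\sum_{i=1}^n c_ix_i$ subject to $\sum_{j\in R_i}\alpha_{ij}(x_j-y_{ij})\le\left(\sum_{j\in R_i}\alpha_{ij}\right)(1-x_i)$ for $i=1,\dots,n$; $y_{ij}+y_{ji}-2x_i\le 0$ for all $j\in R_i$, $i=1,\dots,n$; $x_i\in\{0,1\}$ for all $i$; $0\le y_{ij}\le 1$ for all $j\in R_i$, $i=1,\dots,n$. Then PK($\alpha$) is a valid formulation of QUBO.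
   Context: QUBO is the problem: maximize $\sum_{i=1}^n\sum_{j\in R_i}q_{ij}x_ix_j+\sum_{i=1}^n c_ix_i$ over $x\in\{0,1\}^n$. An MILP in variables $(x,y)$ with objective $\sum_i\sum_{j\in R_i}q_{ij}y_{ij}+\sum_i c_ix_i$ is a valid formulation of QUBO if its optimal objective value equals the optimal value of QUBO and the $x$-part of every optimal solution of the MILP is an optimal solution of QUBO. *)

theory Defs
  imports "HOL-Analysis.Analysis"
begin

definition R :: "real ^ 'n ^ 'n \<Rightarrow> 'n \<Rightarrow> 'n set" where
  "R Q i = {j. Q $ i $ j \<noteq> 0}"

definition binary :: "(real ^ 'n) set" where
  "binary = {x. \<forall>i. x $ i \<in> {0, 1}}"

definition qubo_obj :: "real ^ 'n ^ 'n \<Rightarrow> real ^ 'n \<Rightarrow> real ^ 'n \<Rightarrow> real" where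
  "qubo_obj Q c x =
     (\<Sum>i\<in>UNIV. \<Sum>j\<in>R Q i. Q $ i $ j * x $ i * x $ j) + (\<Sum>i\<in>UNIV. c $ i * x $ i)"

definition milp_obj ::
    "real ^ 'n ^ 'n \<Rightarrow> real ^ 'n \<Rightarrow> (real ^ 'n) \<times> ('n \<times> 'n \<Rightarrow> real) \<Rightarrow> real" where
  "milp_obj Q c = (\<lambda>(x, y).
     (\<Sum>i\<in>UNIV. \<Sum>j\<in>R Q i. Q $ i $ j * y (i, j)) + (\<Sum>i\<in>UNIV. c $ i * x $ i))"

(* A maximization problem has an optimal value only if the maximum is attained. In particular
   this is false for every v when the problem is infeasible or unbounded. *)
definition has_optimal_value :: "('a \<Rightarrow> real) \<Rightarrow> 'a set \<Rightarrow> real \<Rightarrow> bool" where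
  "has_optimal_value f S v \<longleftrightarrow> (\<exists>z. is_arg_max f (\<lambda>z. z \<in> S) z \<and> f z = v)"

(* F is the feasible set of the MILP. *)
definition valid_formulation ::
    "real ^ 'n ^ 'n \<Rightarrow> real ^ 'n \<Rightarrow> ((real ^ 'n) \<times> ('n \<times> 'n \<Rightarrow> real)) set \<Rightarrow> bool" where
  "valid_formulation Q c F \<longleftrightarrow>
     (\<exists>v. has_optimal_value (milp_obj Q c) F v \<and> has_optimal_value (qubo_obj Q c) binary v) \<and>
     (\<forall>x y. is_arg_max (milp_obj Q c) (\<lambda>z. z \<in> F) (x, y) \<longrightarrow>
            is_arg_max (qubo_obj Q c) (\<lambda>x. x \<in> binary) x)"

(* The variables y_ij exist only for j in R_i, so y is taken extensional on those pairs. *)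
definition PK :: "real ^ 'n ^ 'n \<Rightarrow> ('n \<Rightarrow> 'n \<Rightarrow> real) \<Rightarrow>
    ((real ^ 'n) \<times> ('n \<times> 'n \<Rightarrow> real)) set" where
  "PK Q \<alpha> = {(x, y).
     y \<in> extensional (SIGMA i:UNIV. R Q i) \<and>
     (\<forall>i. (\<Sum>j\<in>R Q i. \<alpha> i j * (x $ j - y (i, j))) \<le> (\<Sum>j\<in>R Q i. \<alpha> i j) * (1 - x $ i)) \<and>
     (\<forall>i. \<forall>j\<in>R Q i. y (i, j) + y (j, i) - 2 * x $ i \<le> 0) \<and>
     x \<in> binary \<and>
     (\<forall>i. \<forall>j\<in>R Q i. 0 \<le> y (i, j) \<and> y (i, j) \<le> 1)}"

end

theory Submission imports Defs begin

text \<open>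
  Let (x, y) be feasible. If \<open>x\<^sub>i = 0\<close>, the second family of constraints and symmetry of R force
  \<open>y\<^sub>i\<^sub>j = y\<^sub>j\<^sub>i = 0\<close>. If \<open>x\<^sub>i = 1\<close>, the knapsack constraint says that a sum of the terms
  \<open>\<alpha>\<^sub>i\<^sub>j (x\<^sub>j - y\<^sub>i\<^sub>j)\<close>, which are then all nonnegative, is at most 0, so \<open>y\<^sub>i\<^sub>j = x\<^sub>j\<close>. Hence
  the feasible set is exactly the graph of \<open>x \<mapsto> (x\<^sub>i x\<^sub>j)\<close> over the binary vectors, and the two
  objectives agree along it.
\<close>

text \<open>\<open>restrict\<close> makes the second component extensional, as \<open>PK\<close>
  demands, so a feasible point can equal a lift outright.\<close>

definition product_lift :: "real ^ 'n ^ 'n \<Rightarrow> real ^ 'n \<Rightarrow> (real ^ 'n) \<times> ('n \<times> 'n \<Rightarrow> real)" where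
  "product_lift Q x = (x, restrict (\<lambda>(i, j). x $ i * x $ j) (SIGMA i:UNIV. R Q i))"

lemma milp_obj_product_lift: "milp_obj Q c (product_lift Q x) = qubo_obj Q c x"
  by (simp add: milp_obj_def qubo_obj_def product_lift_def mult.assoc)

lemma binary_cases:
  assumes "x \<in> binary"
  obtains "x $ i = 0" | "x $ i = 1"
  using assms by (auto simp: binary_def)

text \<open>A binary vector is the indicator of its support. Finiteness is what makes the QUBO
  maximum attained.\<close>

lemma finite_binary: "finite (binary :: (real ^ 'n) set)"
proof (rule finite_subset)
  show "(binary :: (real ^ 'n) set) \<subseteq> range (\<lambda>S. \<chi> i. indicator S i)"
  proof
    fix x :: "real ^ 'n"
    assume "x \<in> binary"
    then have "x = (\<chi> i. indicator {i. x $ i = 1} i)"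
      by (auto simp: binary_def vec_eq_iff indicator_def)
    then show "x \<in> range (\<lambda>S. \<chi> i. indicator S i)"
      by blast
  qed
qed simp

lemma R_sym:
  assumes "transpose Q = Q"
  shows "j \<in> R Q i \<longleftrightarrow> i \<in> R Q j"
proof -
  have "Q $ i $ j = Q $ j $ i"
    using assms by (metis transpose_def vec_lambda_beta)
  then show ?thesis
    by (simp add: R_def)
qed

lemma PK_imp_product:
  assumes sym: "transpose Q = Q"
    and pos: "\<forall>i. \<forall>j\<in>R Q i. \<alpha> i j > 0"
    and PK: "(x, y) \<in> PK Q \<alpha>"
    and j: "j \<in> R Q i"
  shows "y (i, j) = x $ i * x $ j"
proof -
  have x: "x \<in> binary"
    and knapsack: "(\<Sum>j\<in>R Q i. \<alpha> i j * (x $ j - y (i, j))) \<le> (\<Sum>j\<in>R Q i. \<alpha> i j) * (1 - x $ i)"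
    and pair: "\<And>i j. j \<in> R Q i \<Longrightarrow> y (i, j) + y (j, i) \<le> 2 * x $ i"
    and bounds: "\<And>i j. j \<in> R Q i \<Longrightarrow> 0 \<le> y (i, j) \<and> y (i, j) \<le> 1"
    using PK by (auto simp: PK_def)
  have zero: "y (i, k) = 0" if "k \<in> R Q i" "x $ i = 0 \<or> x $ k = 0" for k
  proof -
    \<comment> \<open>By symmetry the pair constraint also holds with \<open>k\<close> and
      \<open>i\<close> exchanged, so the one sum \<open>y (i, k) + y (k, i)\<close> is bounded by
      both \<open>2 * x $ i\<close> and \<open>2 * x $ k\<close>.\<close>
    have "i \<in> R Q k"
      using that R_sym[OF sym] by blast
    then show ?thesis
      using that pair[of k i] pair[of i k] bounds[of k i] bounds[of i k] by auto
  qed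
  show ?thesis
  proof (cases rule: binary_cases[OF x, of i])
    case 1
    then show ?thesis
      using zero[OF j] by simp
  next
    case 2
    have nonneg: "0 \<le> \<alpha> i k * (x $ k - y (i, k))" if k: "k \<in> R Q i" for k
    proof -
      \<comment> \<open>For \<open>x $ k = 0\<close> this is \<open>zero\<close>; for
        \<open>x $ k = 1\<close> it is the upper bound on \<open>y\<close>.\<close>
      have "y (i, k) \<le> x $ k"
        using zero[OF k] bounds[OF k] by (cases rule: binary_cases[OF x, of k]) auto
      then show ?thesis
        using pos k by (simp add: less_imp_le)
    qed
    have "(\<Sum>k\<in>R Q i. \<alpha> i k * (x $ k - y (i, k))) = 0"
    proof (rule antisym)
      show "(\<Sum>k\<in>R Q i. \<alpha> i k * (x $ k - y (i, k))) \<le> 0"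
        using knapsack 2 by simp
    qed (simp add: sum_nonneg nonneg)
    then have "\<alpha> i j * (x $ j - y (i, j)) = 0"
      using nonneg j by (subst (asm) sum_nonneg_eq_0_iff) auto
    then show ?thesis
      using 2 pos[rule_format, OF j] by simp
  qed
qed

lemma PK_eq_product_lift:
  assumes sym: "transpose Q = Q"
    and pos: "\<forall>i. \<forall>j\<in>R Q i. \<alpha> i j > 0"
  shows "PK Q \<alpha> = product_lift Q ` binary"
proof (intro equalityI subsetI)
  fix z
  assume z: "z \<in> PK Q \<alpha>"
  obtain x y where [simp]: "z = (x, y)"
    by fastforce
  have "y = restrict (\<lambda>(i, j). x $ i * x $ j) (SIGMA i:UNIV. R Q i)"
  proof (rule extensionalityI)
    show "y \<in> extensional (SIGMA i:UNIV. R Q i)"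
      using z by (simp add: PK_def)
  qed (use PK_imp_product[OF sym pos] z in auto)
  moreover have "x \<in> binary"
    using z by (simp add: PK_def)
  ultimately show "z \<in> product_lift Q ` binary"
    by (simp add: product_lift_def)
next
  fix z
  assume "z \<in> product_lift Q ` binary"
  then obtain x where x: "x \<in> binary" and z: "z = product_lift Q x"
    by blast
  have prod: "0 \<le> x $ i * x $ j" "x $ i * x $ j \<le> x $ i" "x $ i * x $ j \<le> 1" for i j
    by (cases rule: binary_cases[OF x, of i]; cases rule: binary_cases[OF x, of j]; simp)+
  \<comment> \<open>The inequality holds term by term, since
    \<open>x $ j - x $ i * x $ j = x $ j * (1 - x $ i)\<close> and \<open>x $ j\<close> is at most
    1.\<close>
  have "(\<Sum>j\<in>R Q i. \<alpha> i j * (x $ j - x $ i * x $ j)) \<le> (\<Sum>j\<in>R Q i. \<alpha> i j) * (1 - x $ i)" for i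
    unfolding sum_distrib_right
  proof (rule sum_mono)
    fix j
    assume "j \<in> R Q i"
    then have "0 \<le> \<alpha> i j"
      using pos by (simp add: less_imp_le)
    then show "\<alpha> i j * (x $ j - x $ i * x $ j) \<le> \<alpha> i j * (1 - x $ i)"
      by (cases rule: binary_cases[OF x, of i]; cases rule: binary_cases[OF x, of j]; simp)
  qed
  moreover have "x $ i * x $ j + x $ j * x $ i - 2 * x $ i \<le> 0" for i j
    using prod(2)[of i j] by (simp add: mult.commute[of "x $ j"])
  \<comment> \<open>The pair constraint also evaluates the lift at \<open>(j, i)\<close>; symmetry
    of \<open>R\<close> keeps that pair inside the domain of \<open>restrict\<close>, where the
    value is the product and not \<open>undefined\<close>.\<close>
  ultimately show "z \<in> PK Q \<alpha>"
    unfolding PK_def z product_lift_def using x prod(1,3) by (auto dest: R_sym[OF sym, THEN iffD1])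
qed

text \<open>The lift preserves objective values, so it carries maximizers to maximizers in both
  directions.\<close>

lemma is_arg_max_product_lift_iff:
  "is_arg_max (milp_obj Q c) (\<lambda>z. z \<in> product_lift Q ` binary) z \<longleftrightarrow>
     (\<exists>x. z = product_lift Q x \<and> is_arg_max (qubo_obj Q c) (\<lambda>x. x \<in> binary) x)"
  by (auto simp: is_arg_max_def milp_obj_product_lift)

lemma ex_is_arg_max_qubo: "\<exists>x. is_arg_max (qubo_obj Q c) (\<lambda>x. x \<in> binary) x"
proof -
  have "(0 :: real ^ 'n) \<in> binary"
    by (simp add: binary_def)
  then obtain x where "is_arg_min (\<lambda>x. - qubo_obj Q c x) (\<lambda>x. x \<in> binary) x"
    using ex_is_arg_min_if_finite[OF finite_binary] by blast
  then show ?thesis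
    by (auto simp: is_arg_min_def is_arg_max_def)
qed

theorem theorem3:
  fixes Q :: "real ^ 'n ^ 'n" and c :: "real ^ 'n" and \<alpha> :: "'n \<Rightarrow> 'n \<Rightarrow> real"
  assumes "transpose Q = Q"
    and "\<forall>i. Q $ i $ i = 0"
    and "\<forall>i. \<forall>j\<in>R Q i. \<alpha> i j > 0"
  shows "valid_formulation Q c (PK Q \<alpha>)"
proof -
  note iff = is_arg_max_product_lift_iff[of Q c, folded PK_eq_product_lift[OF assms(1,3)]]
  obtain x where x: "is_arg_max (qubo_obj Q c) (\<lambda>x. x \<in> binary) x"
    using ex_is_arg_max_qubo by blast
  then have "has_optimal_value (milp_obj Q c) (PK Q \<alpha>) (qubo_obj Q c x)"
    unfolding has_optimal_value_def iff using milp_obj_product_lift by blast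
  moreover have "has_optimal_value (qubo_obj Q c) binary (qubo_obj Q c x)"
    unfolding has_optimal_value_def using x by blast
  \<comment> \<open>The first component of \<open>product_lift Q x\<close> is \<open>x\<close>, so
    the \<open>x\<close>-part of an optimal pair is a QUBO maximizer by \<open>iff\<close>.\<close>
  ultimately show ?thesis
    unfolding valid_formulation_def iff by (auto simp: product_lift_def)
qed

end
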